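(* Let $A$ be an evolution algebra over a field $K$ with natural basis $B=\{e_i\}_{i\in\Lambda}$ and let $I$ be a proper ideal of $A$. Let $E$ be the graph associated to $A$ relative to $B$. Then the following assertions are equivalent: (i) $I$ is a prime ideal. (ii) $E/H_I$ is downward directed and $A/I$ is semiprime.
   Context: Algebras are not assumed associative. An evolution algebra over $K$ is a $K$-algebra $A$ having a basis $B=\{e_i\}_{i\in\Lambda}$ (a natural basis) with $e_ie_j=0$ for all $i\ne j$. Write $e_i^2=\sum_{j\in\Lambda}\omega_{ji}e_j$. The directed graph $E$ associated to $A$ relative to $B$ has vertex set $E^0=\{e_i\}_{i\in\Lambda}$ and exactly one edge from $e_i$ to $e_j$ if $\omega_{ji}\neq 0$, and none otherwise. For an ideal $I$ of $A$, $H_I:=\{e_i\in E^0: e_i^2\in I\}$. For $S\subseteq E^0$, the graph $E/S$ has vertex set $E^0\setminus S$ and edges those edges of $E$ whose source and range both lie outside $S$. For vertices $u,v$ of a graph write $u\ge v$ if there is a directed path from $u$ to $v$ (paths of length $0$ allowed). A graph is downward directed if for all vertices $u,v$ there exists a vertex $z$ with $u\ge z$ and $v\ge z$. An algebra is prime if for any ideals $J,L$ with $JL=0$ one has $J=0$ or $L=0$; it is semiprime if any ideal $J$ with $J^2=0$ is $0$. A proper ideal $I$ of $A$ is a prime ideal if the quotient $A/I$ is prime. *)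

theory Defs
  imports
    "Graph_Theory.Graph_Theory"
    "HOL-Algebra.Module"
    "HOL-Algebra.QuotRing"
    "HOL-Algebra.Ideal_Product"
begin

text \<open>
  Algebras are represented by the record type of HOL-Algebra modules, which already carries a
  multiplication. Its field \<open>one\<close> plays no role: algebras need neither be unital nor associative.
\<close>

locale nonassoc_algebra = Module.module K A + field K for K (structure) and A (structure) +
  assumes mult_closed:
      "\<lbrakk>x \<in> carrier A; y \<in> carrier A\<rbrakk> \<Longrightarrow> x \<otimes>\<^bsub>A\<^esub> y \<in> carrier A"
    and mult_l_distr:
      "\<lbrakk>x \<in> carrier A; y \<in> carrier A; z \<in> carrier A\<rbrakk> \<Longrightarrow>
        (x \<oplus>\<^bsub>A\<^esub> y) \<otimes>\<^bsub>A\<^esub> z = x \<otimes>\<^bsub>A\<^esub> z \<oplus>\<^bsub>A\<^esub> y \<otimes>\<^bsub>A\<^esub> z"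
    and mult_r_distr:
      "\<lbrakk>x \<in> carrier A; y \<in> carrier A; z \<in> carrier A\<rbrakk> \<Longrightarrow>
        z \<otimes>\<^bsub>A\<^esub> (x \<oplus>\<^bsub>A\<^esub> y) = z \<otimes>\<^bsub>A\<^esub> x \<oplus>\<^bsub>A\<^esub> z \<otimes>\<^bsub>A\<^esub> y"
    and mult_smult_l:
      "\<lbrakk>k \<in> carrier K; x \<in> carrier A; y \<in> carrier A\<rbrakk> \<Longrightarrow>
        (k \<odot>\<^bsub>A\<^esub> x) \<otimes>\<^bsub>A\<^esub> y = k \<odot>\<^bsub>A\<^esub> (x \<otimes>\<^bsub>A\<^esub> y)"
    and mult_smult_r:
      "\<lbrakk>k \<in> carrier K; x \<in> carrier A; y \<in> carrier A\<rbrakk> \<Longrightarrow>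
        x \<otimes>\<^bsub>A\<^esub> (k \<odot>\<^bsub>A\<^esub> y) = k \<odot>\<^bsub>A\<^esub> (x \<otimes>\<^bsub>A\<^esub> y)"

locale algebra_ideal = submodule I K A for I and K and A (structure) +
  assumes l_absorb: "\<lbrakk>x \<in> carrier A; y \<in> I\<rbrakk> \<Longrightarrow> x \<otimes> y \<in> I"
    and r_absorb: "\<lbrakk>x \<in> carrier A; y \<in> I\<rbrakk> \<Longrightarrow> y \<otimes> x \<in> I"

text \<open>
  This is the quotient ring \<^const>\<open>FactRing\<close> extended by the induced scalar multiplication. The union
  over representatives collapses to a single coset; merely scaling a coset elementwise would not
  give a coset for the scalar zero.
\<close>

definition quotient_algebra ::
    "('k, 'a, 'm) module_scheme \<Rightarrow> 'a set \<Rightarrow> ('k, 'a set) Module.module" where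
  "quotient_algebra A I =
    ring.extend (A Quot I)
      (Module.module.fields (\<lambda>k C. \<Union>x\<in>C. I +>\<^bsub>A\<^esub> (k \<odot>\<^bsub>A\<^esub> x)))"

text \<open>
  For subspaces \<open>J\<close> and \<open>L\<close>, the set \<^term>\<open>ideal_prod A J L\<close> of finite sums of products is the
  linear span of all products.
\<close>

definition prime_algebra ::
    "('k, 'r) ring_scheme \<Rightarrow> ('k, 'a, 'm) module_scheme \<Rightarrow> bool" where
  "prime_algebra K A \<longleftrightarrow>
    (\<forall>J L. algebra_ideal J K A \<longrightarrow> algebra_ideal L K A \<longrightarrow>
      ideal_prod A J L = {\<zero>\<^bsub>A\<^esub>} \<longrightarrow> J = {\<zero>\<^bsub>A\<^esub>} \<or> L = {\<zero>\<^bsub>A\<^esub>})"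

definition semiprime_algebra ::
    "('k, 'r) ring_scheme \<Rightarrow> ('k, 'a, 'm) module_scheme \<Rightarrow> bool" where
  "semiprime_algebra K A \<longleftrightarrow>
    (\<forall>J. algebra_ideal J K A \<longrightarrow> ideal_prod A J J = {\<zero>\<^bsub>A\<^esub>} \<longrightarrow> J = {\<zero>\<^bsub>A\<^esub>})"

definition prime_algebra_ideal ::
    "('k, 'r) ring_scheme \<Rightarrow> ('k, 'a, 'm) module_scheme \<Rightarrow> 'a set \<Rightarrow> bool" where
  "prime_algebra_ideal K A I \<longleftrightarrow>
    algebra_ideal I K A \<and> I \<noteq> carrier A \<and> prime_algebra K (quotient_algebra A I)"

text \<open>
  Coefficient families are extensional, i.e. \<^const>\<open>undefined\<close> outside the index set, so that
  the coordinates of a vector are unique as a function.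
\<close>

definition fin_coeffs :: "('k, 'r) ring_scheme \<Rightarrow> 'i set \<Rightarrow> ('i \<Rightarrow> 'k) set" where
  "fin_coeffs K \<Lambda> = {c \<in> \<Lambda> \<rightarrow>\<^sub>E carrier K. finite {i \<in> \<Lambda>. c i \<noteq> \<zero>\<^bsub>K\<^esub>}}"

definition lin_comb ::
    "('k, 'r) ring_scheme \<Rightarrow> ('k, 'a, 'm) module_scheme \<Rightarrow> 'i set \<Rightarrow> ('i \<Rightarrow> 'a) \<Rightarrow>
      ('i \<Rightarrow> 'k) \<Rightarrow> 'a" where
  "lin_comb K A \<Lambda> e c = (\<Oplus>\<^bsub>A\<^esub>i\<in>{i \<in> \<Lambda>. c i \<noteq> \<zero>\<^bsub>K\<^esub>}. c i \<odot>\<^bsub>A\<^esub> e i)"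

definition vs_basis ::
    "('k, 'r) ring_scheme \<Rightarrow> ('k, 'a, 'm) module_scheme \<Rightarrow> 'i set \<Rightarrow> ('i \<Rightarrow> 'a) \<Rightarrow> bool" where
  "vs_basis K A \<Lambda> e \<longleftrightarrow>
    e \<in> \<Lambda> \<rightarrow> carrier A \<and>
    (\<forall>c\<in>fin_coeffs K \<Lambda>. lin_comb K A \<Lambda> e c = \<zero>\<^bsub>A\<^esub> \<longrightarrow> (\<forall>i\<in>\<Lambda>. c i = \<zero>\<^bsub>K\<^esub>)) \<and>
    (\<forall>x\<in>carrier A. \<exists>c\<in>fin_coeffs K \<Lambda>. x = lin_comb K A \<Lambda> e c)"

definition coordinates ::
    "('k, 'r) ring_scheme \<Rightarrow> ('k, 'a, 'm) module_scheme \<Rightarrow> 'i set \<Rightarrow> ('i \<Rightarrow> 'a) \<Rightarrow>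
      'a \<Rightarrow> 'i \<Rightarrow> 'k" where
  "coordinates K A \<Lambda> e x = (THE c. c \<in> fin_coeffs K \<Lambda> \<and> x = lin_comb K A \<Lambda> e c)"

locale evolution_algebra = nonassoc_algebra K A
  for K (structure) and A (structure) and \<Lambda> :: "'i set" and e :: "'i \<Rightarrow> 'b" +
  assumes basis: "vs_basis K A \<Lambda> e"
    and natural: "\<lbrakk>i \<in> \<Lambda>; j \<in> \<Lambda>; i \<noteq> j\<rbrakk> \<Longrightarrow> e i \<otimes>\<^bsub>A\<^esub> e j = \<zero>\<^bsub>A\<^esub>"

text \<open>
  \<open>structure_const K A \<Lambda> e j i\<close> is the coefficient \<open>\<omega>\<^sub>j\<^sub>i\<close> of \<open>e\<^sub>j\<close> in the square of \<open>e\<^sub>i\<close>.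
\<close>

definition structure_const ::
    "('k, 'r) ring_scheme \<Rightarrow> ('k, 'a, 'm) module_scheme \<Rightarrow> 'i set \<Rightarrow> ('i \<Rightarrow> 'a) \<Rightarrow>
      'i \<Rightarrow> 'i \<Rightarrow> 'k" where
  "structure_const K A \<Lambda> e j i = coordinates K A \<Lambda> e (e i \<otimes>\<^bsub>A\<^esub> e i) j"

definition evolution_graph ::
    "('k, 'r) ring_scheme \<Rightarrow> ('k, 'a, 'm) module_scheme \<Rightarrow> 'i set \<Rightarrow> ('i \<Rightarrow> 'a) \<Rightarrow>
      ('a, 'a \<times> 'a) pre_digraph" where
  "evolution_graph K A \<Lambda> e =
    \<lparr>verts = e ` \<Lambda>,
     arcs = {(e i, e j) | i j. i \<in> \<Lambda> \<and> j \<in> \<Lambda> \<and> structure_const K A \<Lambda> e j i \<noteq> \<zero>\<^bsub>K\<^esub>},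
     tail = fst, head = snd\<rparr>"

definition ideal_vertices ::
    "('k, 'a, 'm) module_scheme \<Rightarrow> 'i set \<Rightarrow> ('i \<Rightarrow> 'a) \<Rightarrow> 'a set \<Rightarrow> 'a set" where
  "ideal_vertices A \<Lambda> e I = {v \<in> e ` \<Lambda>. v \<otimes>\<^bsub>A\<^esub> v \<in> I}"

definition quotient_graph :: "('v, 'w) pre_digraph \<Rightarrow> 'v set \<Rightarrow> ('v, 'w) pre_digraph" where
  "quotient_graph G S = G \<restriction> (verts G - S)"

text \<open>Reachability \<open>u \<rightarrow>\<^sup>* v\<close> includes paths of length zero at every vertex.\<close>

definition downward_directed :: "('v, 'w) pre_digraph \<Rightarrow> bool" where
  "downward_directed G \<longleftrightarrow>
    (\<forall>u\<in>verts G. \<forall>v\<in>verts G. \<exists>z\<in>verts G. u \<rightarrow>\<^sup>*\<^bsub>G\<^esub> z \<and> v \<rightarrow>\<^sup>*\<^bsub>G\<^esub> z)"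

end

theory Submission
  imports Defs
begin

text \<open>
  Ideals of \<open>A/I\<close> are the images of the ideals of \<open>A\<close> containing \<open>I\<close>, so primeness and
  semiprimeness of \<open>A/I\<close> become statements about products of ideals of \<open>A\<close> modulo \<open>I\<close>
  (\<open>prime_quotient_iff\<close>, \<open>semiprime_quotient_iff\<close>). The images of the \<open>e\<^sub>i\<close> in \<open>A/I\<close> can be
  linearly dependent, so \<open>A/I\<close> has no obvious natural basis and all the work takes place in \<open>A\<close>.

  There, multiplication by a basis vector isolates one coordinate: \<open>x e\<^sub>i\<close> is the \<open>i\<close>-th coordinate
  of \<open>x\<close> times \<open>e\<^sub>i\<^sup>2\<close>. So \<open>e\<^sub>i \<rightarrow> e\<^sub>j\<close> is an edge of \<open>E/H\<^sub>I\<close> exactly when \<open>e\<^sub>i\<^sup>2 e\<^sub>j \<notin> I\<close>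
  (\<open>adj_G_iff\<close>), and an ideal containing the square of a vertex of \<open>E/H\<^sub>I\<close> contains the squares of
  all its descendants (\<open>square_mem_ideal_reachable\<close>).

  The central object is, for a set \<open>D\<close> of indices, the set \<open>S\<^sub>D\<close> of those \<open>x\<close> with \<open>x e\<^sub>i \<in> I\<close> for
  all \<open>i \<notin> D\<close> (\<open>supported_on\<close>). It is an ideal as soon as no edge of \<open>E/H\<^sub>I\<close> leaves \<open>D\<close>, and
  \<open>S\<^sub>D S\<^sub>D\<^sub>' \<subseteq> I\<close> if \<open>D\<close> and \<open>D'\<close> are disjoint.

  Let \<open>A/I\<close> be prime, and let \<open>D\<close> and \<open>D'\<close> be the sets of descendants of two vertices of \<open>E/H\<^sub>I\<close>.
  Then \<open>S\<^sub>D\<close> and \<open>S\<^sub>D\<^sub>'\<close> are ideals larger than \<open>I\<close>, since they contain the squares of these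
  vertices. So their product is not contained in \<open>I\<close>, and \<open>D\<close> meets \<open>D'\<close>.

  Conversely, let \<open>E/H\<^sub>I\<close> be downward directed and \<open>A/I\<close> semiprime. The ideal \<open>S\<^sub>D\<close> for empty \<open>D\<close> has
  its square in \<open>I\<close>, so it equals \<open>I\<close>; hence each ideal larger than \<open>I\<close> contains the square of
  a vertex of \<open>E/H\<^sub>I\<close> (\<open>larger_ideal_contains_square\<close>). If \<open>J\<close> and \<open>L\<close> are both larger than \<open>I\<close>, they
  contain the square of a common descendant, so \<open>J \<inter> L \<noteq> I\<close>. But \<open>(J \<inter> L)\<^sup>2 \<subseteq> JL\<close>, so
  semiprimeness excludes \<open>JL \<subseteq> I\<close>.
\<close>

section \<open>Ideals of nonassociative algebras\<close>

context nonassoc_algebra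
begin

text \<open>
  Closure under negation is not among the conditions because \<open>- x = (- 1) x\<close>.
\<close>

lemma algebra_idealI:
  assumes "J \<subseteq> carrier A" and "\<zero>\<^bsub>A\<^esub> \<in> J"
    and add: "\<And>x y. \<lbrakk>x \<in> J; y \<in> J\<rbrakk> \<Longrightarrow> x \<oplus>\<^bsub>A\<^esub> y \<in> J"
    and smult: "\<And>k x. \<lbrakk>k \<in> carrier K; x \<in> J\<rbrakk> \<Longrightarrow> k \<odot>\<^bsub>A\<^esub> x \<in> J"
    and "\<And>x y. \<lbrakk>x \<in> carrier A; y \<in> J\<rbrakk> \<Longrightarrow> x \<otimes>\<^bsub>A\<^esub> y \<in> J"
    and "\<And>x y. \<lbrakk>x \<in> carrier A; y \<in> J\<rbrakk> \<Longrightarrow> y \<otimes>\<^bsub>A\<^esub> x \<in> J"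
  shows "algebra_ideal J K A"
proof -
  have "\<ominus>\<^bsub>A\<^esub> x \<in> J" if "x \<in> J" for x
  proof -
    have "\<ominus>\<^bsub>A\<^esub> x = (\<ominus> \<one>) \<odot>\<^bsub>A\<^esub> x"
      using that assms(1) by (simp add: smult_l_minus subset_iff)
    then show ?thesis
      using that smult by simp
  qed
  then have "submodule J K A"
    using assms by (intro submoduleI) auto
  then show ?thesis
    using assms by (intro algebra_ideal.intro algebra_ideal_axioms.intro) auto
qed

lemma algebra_idealD:
  assumes "algebra_ideal J K A"
  shows "J \<subseteq> carrier A" and "\<zero>\<^bsub>A\<^esub> \<in> J"
    and "\<And>x. x \<in> J \<Longrightarrow> \<ominus>\<^bsub>A\<^esub> x \<in> J"
    and "\<And>x y. \<lbrakk>x \<in> J; y \<in> J\<rbrakk> \<Longrightarrow> x \<oplus>\<^bsub>A\<^esub> y \<in> J"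
    and "\<And>k x. \<lbrakk>k \<in> carrier K; x \<in> J\<rbrakk> \<Longrightarrow> k \<odot>\<^bsub>A\<^esub> x \<in> J"
    and "\<And>x y. \<lbrakk>x \<in> carrier A; y \<in> J\<rbrakk> \<Longrightarrow> x \<otimes>\<^bsub>A\<^esub> y \<in> J"
    and "\<And>x y. \<lbrakk>x \<in> carrier A; y \<in> J\<rbrakk> \<Longrightarrow> y \<otimes>\<^bsub>A\<^esub> x \<in> J"
proof -
  have sub: "submodule J K A"
    using assms by (rule algebra_ideal.axioms)
  show "J \<subseteq> carrier A" "\<And>x. x \<in> J \<Longrightarrow> \<ominus>\<^bsub>A\<^esub> x \<in> J"
    "\<And>x y. \<lbrakk>x \<in> J; y \<in> J\<rbrakk> \<Longrightarrow> x \<oplus>\<^bsub>A\<^esub> y \<in> J"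
    "\<And>k x. \<lbrakk>k \<in> carrier K; x \<in> J\<rbrakk> \<Longrightarrow> k \<odot>\<^bsub>A\<^esub> x \<in> J"
    using submoduleE[OF sub] by auto
  show "\<zero>\<^bsub>A\<^esub> \<in> J"
    using subgroup.one_closed[OF submodule.axioms(1)[OF sub]] by simp
  show "\<And>x y. \<lbrakk>x \<in> carrier A; y \<in> J\<rbrakk> \<Longrightarrow> x \<otimes>\<^bsub>A\<^esub> y \<in> J"
    "\<And>x y. \<lbrakk>x \<in> carrier A; y \<in> J\<rbrakk> \<Longrightarrow> y \<otimes>\<^bsub>A\<^esub> x \<in> J"
    using algebra_ideal.l_absorb[OF assms] algebra_ideal.r_absorb[OF assms] by auto
qed

lemma algebra_ideal_Int:
  assumes "algebra_ideal J K A" and "algebra_ideal L K A"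
  shows "algebra_ideal (J \<inter> L) K A"
  by (rule algebra_idealI) (use algebra_idealD[OF assms(1)] algebra_idealD[OF assms(2)] in auto)

lemma mult_zero_right [simp]:
  assumes "x \<in> carrier A"
  shows "x \<otimes>\<^bsub>A\<^esub> \<zero>\<^bsub>A\<^esub> = \<zero>\<^bsub>A\<^esub>"
  using mult_smult_r[of \<zero> x "\<zero>\<^bsub>A\<^esub>"] mult_closed[of x "\<zero>\<^bsub>A\<^esub>"] assms by simp

lemma mult_zero_left [simp]:
  assumes "x \<in> carrier A"
  shows "\<zero>\<^bsub>A\<^esub> \<otimes>\<^bsub>A\<^esub> x = \<zero>\<^bsub>A\<^esub>"
  using mult_smult_l[of \<zero> "\<zero>\<^bsub>A\<^esub>" x] mult_closed[of "\<zero>\<^bsub>A\<^esub>" x] assms by simp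

lemma ideal_prod_eq_zero_iff:
  assumes "algebra_ideal J K A" and "algebra_ideal L K A"
  shows "ideal_prod A J L = {\<zero>\<^bsub>A\<^esub>} \<longleftrightarrow> (\<forall>x\<in>J. \<forall>y\<in>L. x \<otimes>\<^bsub>A\<^esub> y = \<zero>\<^bsub>A\<^esub>)"
proof
  assume "ideal_prod A J L = {\<zero>\<^bsub>A\<^esub>}"
  then show "\<forall>x\<in>J. \<forall>y\<in>L. x \<otimes>\<^bsub>A\<^esub> y = \<zero>\<^bsub>A\<^esub>"
    using ideal_prod.prod[of _ J _ L A] by blast
next
  assume zero: "\<forall>x\<in>J. \<forall>y\<in>L. x \<otimes>\<^bsub>A\<^esub> y = \<zero>\<^bsub>A\<^esub>"
  have "s = \<zero>\<^bsub>A\<^esub>" if "s \<in> ideal_prod A J L" for s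
    using that by induction (use zero in auto)
  moreover have "\<zero>\<^bsub>A\<^esub> \<in> ideal_prod A J L"
    using ideal_prod.prod[of "\<zero>\<^bsub>A\<^esub>" J "\<zero>\<^bsub>A\<^esub>" L A] assms by (simp add: algebra_idealD)
  ultimately show "ideal_prod A J L = {\<zero>\<^bsub>A\<^esub>}"
    by blast
qed

end


section \<open>Ideals of a quotient algebra\<close>

locale algebra_with_ideal = nonassoc_algebra K A + algebra_ideal I K A
  for K (structure) and A (structure) and I
begin

abbreviation Q where "Q \<equiv> quotient_algebra A I"

lemma ideal_I: "algebra_ideal I K A"
  by (rule algebra_ideal_axioms)

lemmas I_closed = algebra_idealD[OF ideal_I]

sublocale I: abelian_subgroup I A
  by (rule abelian_subgroupI3)
    (auto intro: additive_subgroupI subgroup_axioms abelian_group_axioms M.abelian_group_axioms)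

lemma coset_add_left:
  assumes "h \<in> I" and "x \<in> carrier A"
  shows "I +>\<^bsub>A\<^esub> (h \<oplus>\<^bsub>A\<^esub> x) = I +>\<^bsub>A\<^esub> x"
proof -
  have "h \<oplus>\<^bsub>A\<^esub> x \<in> I +>\<^bsub>A\<^esub> x"
    using assms by (auto simp: a_r_coset_def')
  then show ?thesis
    using I.a_repr_independence' assms(2) by simp
qed

lemma cosetE:
  assumes "a \<in> I +>\<^bsub>A\<^esub> x"
  obtains h where "h \<in> I" and "a = h \<oplus>\<^bsub>A\<^esub> x"
  using assms by (auto simp: a_r_coset_def')

lemma coset_eq_I_iff:
  assumes "x \<in> carrier A"
  shows "I +>\<^bsub>A\<^esub> x = I \<longleftrightarrow> x \<in> I"
  using I.a_rcos_self[OF assms] I.a_rcos_const by auto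

lemma carrier_Q: "carrier Q = (\<lambda>x. I +>\<^bsub>A\<^esub> x) ` carrier A"
  by (auto simp: quotient_algebra_def ring.defs FactRing_def A_RCOSETS_def')

lemma zero_Q: "\<zero>\<^bsub>Q\<^esub> = I"
  by (simp add: quotient_algebra_def ring.defs FactRing_def)

lemma add_Q:
  assumes "x \<in> carrier A" and "y \<in> carrier A"
  shows "(I +>\<^bsub>A\<^esub> x) \<oplus>\<^bsub>Q\<^esub> (I +>\<^bsub>A\<^esub> y) = I +>\<^bsub>A\<^esub> (x \<oplus>\<^bsub>A\<^esub> y)"
  using assms by (simp add: quotient_algebra_def ring.defs FactRing_def I.a_rcos_sum)

text \<open>
  \<open>(h + x)(h' + y) = (h (h' + y) + x h') + x y\<close> with the bracket in \<open>I\<close>, so the union of cosets in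
  the definition of the product collapses.
\<close>

lemma mult_Q:
  assumes "x \<in> carrier A" and "y \<in> carrier A"
  shows "(I +>\<^bsub>A\<^esub> x) \<otimes>\<^bsub>Q\<^esub> (I +>\<^bsub>A\<^esub> y) = I +>\<^bsub>A\<^esub> (x \<otimes>\<^bsub>A\<^esub> y)"
proof -
  have "I +>\<^bsub>A\<^esub> (a \<otimes>\<^bsub>A\<^esub> b) = I +>\<^bsub>A\<^esub> (x \<otimes>\<^bsub>A\<^esub> y)"
    if a: "a \<in> I +>\<^bsub>A\<^esub> x" and b: "b \<in> I +>\<^bsub>A\<^esub> y" for a b
  proof -
    obtain h where h: "h \<in> I" "a = h \<oplus>\<^bsub>A\<^esub> x"
      using a by (rule cosetE)
    obtain h' where h': "h' \<in> I" "b = h' \<oplus>\<^bsub>A\<^esub> y"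
      using b by (rule cosetE)
    have carr: "h \<in> carrier A" "h' \<in> carrier A" "b \<in> carrier A"
      using h h' assms I_closed(1) by auto
    have "a \<otimes>\<^bsub>A\<^esub> b = h \<otimes>\<^bsub>A\<^esub> b \<oplus>\<^bsub>A\<^esub> x \<otimes>\<^bsub>A\<^esub> b"
      using h(2) carr assms by (simp add: mult_l_distr)
    also have "x \<otimes>\<^bsub>A\<^esub> b = x \<otimes>\<^bsub>A\<^esub> h' \<oplus>\<^bsub>A\<^esub> x \<otimes>\<^bsub>A\<^esub> y"
      using h'(2) carr assms by (simp add: mult_r_distr)
    also have "h \<otimes>\<^bsub>A\<^esub> b \<oplus>\<^bsub>A\<^esub> \<dots> = (h \<otimes>\<^bsub>A\<^esub> b \<oplus>\<^bsub>A\<^esub> x \<otimes>\<^bsub>A\<^esub> h') \<oplus>\<^bsub>A\<^esub> x \<otimes>\<^bsub>A\<^esub> y"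
      using carr assms by (simp add: mult_closed M.a_assoc)
    finally show ?thesis
      using h(1) h'(1) carr assms I_closed(4,6,7) by (simp add: coset_add_left mult_closed)
  qed
  then have "(\<Union>a\<in>I +>\<^bsub>A\<^esub> x. \<Union>b\<in>I +>\<^bsub>A\<^esub> y. I +>\<^bsub>A\<^esub> (a \<otimes>\<^bsub>A\<^esub> b)) = I +>\<^bsub>A\<^esub> (x \<otimes>\<^bsub>A\<^esub> y)"
    using I.a_rcos_self assms by blast
  then show ?thesis
    by (simp add: quotient_algebra_def ring.defs FactRing_def rcoset_mult_def)
qed

lemma smult_Q:
  assumes "k \<in> carrier K" and "x \<in> carrier A"
  shows "k \<odot>\<^bsub>Q\<^esub> (I +>\<^bsub>A\<^esub> x) = I +>\<^bsub>A\<^esub> (k \<odot>\<^bsub>A\<^esub> x)"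
proof -
  have "I +>\<^bsub>A\<^esub> (k \<odot>\<^bsub>A\<^esub> a) = I +>\<^bsub>A\<^esub> (k \<odot>\<^bsub>A\<^esub> x)" if a: "a \<in> I +>\<^bsub>A\<^esub> x" for a
  proof -
    obtain h where h: "h \<in> I" "a = h \<oplus>\<^bsub>A\<^esub> x"
      using a by (rule cosetE)
    have "h \<in> carrier A"
      using h I_closed(1) by blast
    then have "k \<odot>\<^bsub>A\<^esub> a = k \<odot>\<^bsub>A\<^esub> h \<oplus>\<^bsub>A\<^esub> k \<odot>\<^bsub>A\<^esub> x"
      using h assms by (simp add: smult_r_distr)
    then show ?thesis
      using h assms I_closed(5) by (simp add: coset_add_left)
  qed
  then have "(\<Union>a\<in>I +>\<^bsub>A\<^esub> x. I +>\<^bsub>A\<^esub> (k \<odot>\<^bsub>A\<^esub> a)) = I +>\<^bsub>A\<^esub> (k \<odot>\<^bsub>A\<^esub> x)"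
    using I.a_rcos_self assms by blast
  then show ?thesis
    by (simp add: quotient_algebra_def ring.defs module.defs FactRing_def)
qed

lemma nonassoc_algebra_Q: "nonassoc_algebra K Q"
proof -
  note ops = carrier_Q zero_Q add_Q mult_Q smult_Q
  have "abelian_group Q"
  proof (rule abelian_groupI)
    fix X assume "X \<in> carrier Q"
    then obtain x where x: "x \<in> carrier A" "X = I +>\<^bsub>A\<^esub> x"
      by (auto simp: carrier_Q)
    have "(I +>\<^bsub>A\<^esub> (\<ominus>\<^bsub>A\<^esub> x)) \<oplus>\<^bsub>Q\<^esub> X = \<zero>\<^bsub>Q\<^esub>"
      using x coset_eq_I_iff[of "\<zero>\<^bsub>A\<^esub>"] I_closed(2) by (simp add: ops M.l_neg)
    then show "\<exists>Y\<in>carrier Q. Y \<oplus>\<^bsub>Q\<^esub> X = \<zero>\<^bsub>Q\<^esub>"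
      using x by (auto simp: carrier_Q intro!: bexI[of _ "I +>\<^bsub>A\<^esub> (\<ominus>\<^bsub>A\<^esub> x)"])
    have "I = I +>\<^bsub>A\<^esub> \<zero>\<^bsub>A\<^esub>"
      using coset_eq_I_iff[of "\<zero>\<^bsub>A\<^esub>"] I_closed(2) by simp
    then show "\<zero>\<^bsub>Q\<^esub> \<oplus>\<^bsub>Q\<^esub> X = X"
      using x add_Q[of "\<zero>\<^bsub>A\<^esub>" x] by (simp add: zero_Q)
  next
    show "\<zero>\<^bsub>Q\<^esub> \<in> carrier Q"
      using coset_eq_I_iff[of "\<zero>\<^bsub>A\<^esub>"] I_closed(2) by (force simp: carrier_Q zero_Q)
  qed (auto simp: carrier_Q add_Q M.a_ac)
  then have "Module.module K Q"
    by (intro moduleI R.is_cring)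
      (auto simp: ops smult_l_distr smult_r_distr smult_assoc1)
  then show ?thesis
    by (intro nonassoc_algebra.intro nonassoc_algebra_axioms.intro field_axioms)
      (auto simp: ops mult_closed mult_l_distr mult_r_distr mult_smult_l mult_smult_r)
qed

lemma ideal_Q_iff:
  "algebra_ideal J' K Q \<longleftrightarrow>
    (\<exists>J. algebra_ideal J K A \<and> I \<subseteq> J \<and> J' = (\<lambda>x. I +>\<^bsub>A\<^esub> x) ` J)" (is "?l \<longleftrightarrow> ?r")
proof
  assume ideal: ?l
  note J' = nonassoc_algebra.algebra_idealD[OF nonassoc_algebra_Q ideal]
  let ?J = "{x \<in> carrier A. I +>\<^bsub>A\<^esub> x \<in> J'}"
  have I_sub: "I \<subseteq> ?J"
    using J'(2) I_closed(1) by (auto simp: I.a_rcos_const zero_Q)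
  have "algebra_ideal ?J K A"
  proof (rule algebra_idealI)
    show "\<zero>\<^bsub>A\<^esub> \<in> ?J"
      using I_sub I_closed(2) by blast
  next
    fix x y assume "x \<in> ?J" "y \<in> ?J"
    then show "x \<oplus>\<^bsub>A\<^esub> y \<in> ?J"
      using J'(4)[of "I +>\<^bsub>A\<^esub> x" "I +>\<^bsub>A\<^esub> y"] by (simp add: add_Q)
  next
    fix k x assume "k \<in> carrier K" "x \<in> ?J"
    then show "k \<odot>\<^bsub>A\<^esub> x \<in> ?J"
      using J'(5)[of k "I +>\<^bsub>A\<^esub> x"] by (simp add: smult_Q)
  next
    fix x y assume xy: "x \<in> carrier A" "y \<in> ?J"
    then have "I +>\<^bsub>A\<^esub> x \<in> carrier Q"
      by (simp add: carrier_Q)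
    with xy J'(6,7)[of "I +>\<^bsub>A\<^esub> x" "I +>\<^bsub>A\<^esub> y"]
    show "x \<otimes>\<^bsub>A\<^esub> y \<in> ?J" "y \<otimes>\<^bsub>A\<^esub> x \<in> ?J"
      by (simp_all add: mult_Q mult_closed)
  qed auto
  moreover have "J' = (\<lambda>x. I +>\<^bsub>A\<^esub> x) ` ?J"
    using J'(1) by (auto simp: carrier_Q)
  ultimately show ?r
    using I_sub by blast
next
  assume ?r
  then obtain J where ideal: "algebra_ideal J K A" and IJ: "I \<subseteq> J"
    and J': "J' = (\<lambda>x. I +>\<^bsub>A\<^esub> x) ` J"
    by blast
  note J = algebra_idealD[OF ideal]
  have JA: "x \<in> carrier A" if "x \<in> J" for x
    using that J(1) by blast
  show ?l
  proof (rule nonassoc_algebra.algebra_idealI[OF nonassoc_algebra_Q])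
    show "J' \<subseteq> carrier Q"
      using JA by (auto simp: J' carrier_Q)
    show "\<zero>\<^bsub>Q\<^esub> \<in> J'"
      using coset_eq_I_iff[of "\<zero>\<^bsub>A\<^esub>"] I_closed(2) J(2) by (force simp: J' zero_Q)
  qed (auto simp: J' carrier_Q add_Q smult_Q mult_Q JA J(4-7))
qed

lemma image_ideal_eq_zero_iff:
  assumes "J \<subseteq> carrier A" and "I \<subseteq> J"
  shows "(\<lambda>x. I +>\<^bsub>A\<^esub> x) ` J = {\<zero>\<^bsub>Q\<^esub>} \<longleftrightarrow> J = I"
proof -
  have "\<zero>\<^bsub>A\<^esub> \<in> J"
    using assms(2) I_closed(2) by blast
  then have "(\<lambda>x. I +>\<^bsub>A\<^esub> x) ` J = {\<zero>\<^bsub>Q\<^esub>} \<longleftrightarrow> (\<forall>x\<in>J. I +>\<^bsub>A\<^esub> x = I)"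
    using I.a_rcos_const by (auto simp: zero_Q image_iff)
  also have "\<dots> \<longleftrightarrow> J \<subseteq> I"
    using assms coset_eq_I_iff by blast
  finally show ?thesis
    using assms by blast
qed

lemma image_ideal_prod_eq_zero_iff:
  assumes J: "algebra_ideal J K A" "I \<subseteq> J" and L: "algebra_ideal L K A" "I \<subseteq> L"
  shows "ideal_prod Q ((\<lambda>x. I +>\<^bsub>A\<^esub> x) ` J) ((\<lambda>x. I +>\<^bsub>A\<^esub> x) ` L) = {\<zero>\<^bsub>Q\<^esub>} \<longleftrightarrow>
    (\<forall>x\<in>J. \<forall>y\<in>L. x \<otimes>\<^bsub>A\<^esub> y \<in> I)"
proof -
  have "algebra_ideal ((\<lambda>x. I +>\<^bsub>A\<^esub> x) ` J) K Q" "algebra_ideal ((\<lambda>x. I +>\<^bsub>A\<^esub> x) ` L) K Q"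
    using J L ideal_Q_iff by blast+
  note * = nonassoc_algebra.ideal_prod_eq_zero_iff[OF nonassoc_algebra_Q this]
  have "x \<in> carrier A" if "x \<in> J \<union> L" for x
    using that algebra_idealD(1)[OF J(1)] algebra_idealD(1)[OF L(1)] by blast
  then show ?thesis
    unfolding * by (simp add: mult_Q mult_closed coset_eq_I_iff zero_Q)
qed

text \<open>
  This form of the ideal correspondence rewrites a quantifier over ideals of \<open>A/I\<close>, so it can be
  applied to each quantifier of a definition in turn.
\<close>

lemma all_ideals_Q_iff:
  "(\<forall>J'. algebra_ideal J' K Q \<longrightarrow> P J') \<longleftrightarrow>
    (\<forall>J. algebra_ideal J K A \<longrightarrow> I \<subseteq> J \<longrightarrow> P ((\<lambda>x. I +>\<^bsub>A\<^esub> x) ` J))"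
  unfolding ideal_Q_iff by blast

lemma prime_quotient_iff:
  "prime_algebra K Q \<longleftrightarrow>
    (\<forall>J. algebra_ideal J K A \<longrightarrow> I \<subseteq> J \<longrightarrow> (\<forall>L. algebra_ideal L K A \<longrightarrow> I \<subseteq> L \<longrightarrow>
      (\<forall>x\<in>J. \<forall>y\<in>L. x \<otimes>\<^bsub>A\<^esub> y \<in> I) \<longrightarrow> J = I \<or> L = I))"
proof -
  have "prime_algebra K Q \<longleftrightarrow>
    (\<forall>J. algebra_ideal J K Q \<longrightarrow> (\<forall>L. algebra_ideal L K Q \<longrightarrow>
      ideal_prod Q J L = {\<zero>\<^bsub>Q\<^esub>} \<longrightarrow> J = {\<zero>\<^bsub>Q\<^esub>} \<or> L = {\<zero>\<^bsub>Q\<^esub>}))"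
    unfolding prime_algebra_def by simp
  then show ?thesis
    unfolding all_ideals_Q_iff
    by (simp add: image_ideal_eq_zero_iff image_ideal_prod_eq_zero_iff algebra_idealD(1)
      cong: imp_cong)
qed

lemma semiprime_quotient_iff:
  "semiprime_algebra K Q \<longleftrightarrow>
    (\<forall>J. algebra_ideal J K A \<longrightarrow> I \<subseteq> J \<longrightarrow> (\<forall>x\<in>J. \<forall>y\<in>J. x \<otimes>\<^bsub>A\<^esub> y \<in> I) \<longrightarrow> J = I)"
  unfolding semiprime_algebra_def all_ideals_Q_iff
  by (simp add: image_ideal_eq_zero_iff image_ideal_prod_eq_zero_iff algebra_idealD(1)
    cong: imp_cong)

end


section \<open>Coordinates in an evolution algebra\<close>

context evolution_algebra
begin

lemma basis_carrier [simp]: "i \<in> \<Lambda> \<Longrightarrow> e i \<in> carrier A"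
  using basis by (auto simp: vs_basis_def)

text \<open>
  The scalar multiples in the last case have the coefficients \<open>c i\<close> of the given combination, not
  arbitrary ones. This matters in \<open>mult_disjoint_supports\<close>, where a hypothesis on the combination
  has to be used for each of its terms.
\<close>

lemma lin_comb_induct [consumes 1, case_names zero add smult]:
  assumes c: "c \<in> fin_coeffs K \<Lambda>"
    and zero: "P \<zero>\<^bsub>A\<^esub>"
    and add: "\<And>x y. \<lbrakk>x \<in> carrier A; y \<in> carrier A; P x; P y\<rbrakk> \<Longrightarrow> P (x \<oplus>\<^bsub>A\<^esub> y)"
    and smult: "\<And>i. \<lbrakk>i \<in> \<Lambda>; c i \<in> carrier K\<rbrakk> \<Longrightarrow> P (c i \<odot>\<^bsub>A\<^esub> e i)"
  shows "P (lin_comb K A \<Lambda> e c)"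
proof -
  have c_closed: "c i \<in> carrier K" if "i \<in> \<Lambda>" for i
    using c that by (auto simp: fin_coeffs_def)
  have "P (\<Oplus>\<^bsub>A\<^esub>i\<in>F. c i \<odot>\<^bsub>A\<^esub> e i)" if "finite F" "F \<subseteq> \<Lambda>" for F
    using that
  proof (induction F)
    case empty
    then show ?case using zero by simp
  next
    case (insert i F)
    then have "(\<lambda>i. c i \<odot>\<^bsub>A\<^esub> e i) \<in> F \<rightarrow> carrier A"
      using c_closed by auto
    then show ?case
      using insert c_closed by (simp add: add smult)
  qed
  then show ?thesis
    using c by (simp add: lin_comb_def fin_coeffs_def)
qed

lemma carrier_cases_lin_comb:
  assumes "x \<in> carrier A"
  obtains c where "c \<in> fin_coeffs K \<Lambda>" and "x = lin_comb K A \<Lambda> e c"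
  using basis assms by (auto simp: vs_basis_def)

lemma basis_induct [consumes 1, case_names zero add smult]:
  assumes "x \<in> carrier A"
    and "P \<zero>\<^bsub>A\<^esub>"
    and "\<And>x y. \<lbrakk>x \<in> carrier A; y \<in> carrier A; P x; P y\<rbrakk> \<Longrightarrow> P (x \<oplus>\<^bsub>A\<^esub> y)"
    and "\<And>i k. \<lbrakk>i \<in> \<Lambda>; k \<in> carrier K\<rbrakk> \<Longrightarrow> P (k \<odot>\<^bsub>A\<^esub> e i)"
  shows "P x"
  using assms by (metis carrier_cases_lin_comb lin_comb_induct)

lemma mult_commute:
  assumes "x \<in> carrier A" and "y \<in> carrier A"
  shows "x \<otimes>\<^bsub>A\<^esub> y = y \<otimes>\<^bsub>A\<^esub> x"
  using assms(1)
proof (induction rule: basis_induct)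
  case (smult i k)
  have "e i \<otimes>\<^bsub>A\<^esub> y = y \<otimes>\<^bsub>A\<^esub> e i"
    using assms(2)
  proof (induction rule: basis_induct)
    case (smult j l)
    have "e i \<otimes>\<^bsub>A\<^esub> e j = e j \<otimes>\<^bsub>A\<^esub> e i"
      using natural[of i j] natural[of j i] \<open>i \<in> \<Lambda>\<close> \<open>j \<in> \<Lambda>\<close> by (cases "i = j") auto
    then show ?case
      using smult \<open>i \<in> \<Lambda>\<close> by (simp add: mult_smult_l mult_smult_r)
  qed (use \<open>i \<in> \<Lambda>\<close> in \<open>simp_all add: mult_l_distr mult_r_distr\<close>)
  then show ?case
    using smult assms(2) by (simp add: mult_smult_l mult_smult_r)
qed (use assms(2) in \<open>simp_all add: mult_l_distr mult_r_distr\<close>)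

text \<open>
  All other terms vanish because distinct basis vectors annihilate each other.
\<close>

lemma lin_comb_mult_basis:
  assumes c: "c \<in> fin_coeffs K \<Lambda>" and i: "i \<in> \<Lambda>"
  shows "lin_comb K A \<Lambda> e c \<otimes>\<^bsub>A\<^esub> e i = c i \<odot>\<^bsub>A\<^esub> (e i \<otimes>\<^bsub>A\<^esub> e i)"
proof -
  have c_closed: "c j \<in> carrier K" if "j \<in> \<Lambda>" for j
    using c that by (auto simp: fin_coeffs_def)
  have ee: "e i \<otimes>\<^bsub>A\<^esub> e i \<in> carrier A"
    using i by (simp add: mult_closed)
  have "(\<Oplus>\<^bsub>A\<^esub>j\<in>F. c j \<odot>\<^bsub>A\<^esub> e j) \<otimes>\<^bsub>A\<^esub> e i = (if i \<in> F then c i \<odot>\<^bsub>A\<^esub> (e i \<otimes>\<^bsub>A\<^esub> e i) else \<zero>\<^bsub>A\<^esub>)"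
    if "finite F" "F \<subseteq> \<Lambda>" for F
    using that
  proof (induction F)
    case empty
    then show ?case using i by simp
  next
    case (insert j F)
    then have Pi: "(\<lambda>i. c i \<odot>\<^bsub>A\<^esub> e i) \<in> F \<rightarrow> carrier A" and j: "j \<in> \<Lambda>"
      using c_closed by auto
    then have "(\<Oplus>\<^bsub>A\<^esub>j\<in>F. c j \<odot>\<^bsub>A\<^esub> e j) \<in> carrier A"
      by (intro M.finsum_closed)
    moreover have "i \<noteq> j" if "i \<in> F"
      using that insert by blast
    ultimately show ?case
      using insert Pi j i c_closed ee
      by (cases "i = j") (auto simp: mult_l_distr mult_smult_l natural)
  qed
  then show ?thesis
    using c i ee by (auto simp: lin_comb_def fin_coeffs_def)
qed

text \<open>
  Enlarging the range of summation makes combinations with different supports comparable.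
\<close>

lemma lin_comb_superset:
  assumes c: "c \<in> fin_coeffs K \<Lambda>" and F: "finite F" "{i \<in> \<Lambda>. c i \<noteq> \<zero>} \<subseteq> F" "F \<subseteq> \<Lambda>"
  shows "lin_comb K A \<Lambda> e c = (\<Oplus>\<^bsub>A\<^esub>i\<in>F. c i \<odot>\<^bsub>A\<^esub> e i)"
  unfolding lin_comb_def
proof (rule M.add.finprod_mono_neutral_cong_left)
  show "c i \<odot>\<^bsub>A\<^esub> e i = \<zero>\<^bsub>A\<^esub>" if "i \<in> F - {i \<in> \<Lambda>. c i \<noteq> \<zero>}" for i
  proof -
    have "i \<in> \<Lambda>" "c i = \<zero>"
      using that F by auto
    then show ?thesis
      by simp
  qed
  show "(\<lambda>i. c i \<odot>\<^bsub>A\<^esub> e i) \<in> F \<rightarrow> carrier A"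
  proof
    fix i assume "i \<in> F"
    then have "i \<in> \<Lambda>" "c i \<in> carrier K"
      using c F(3) by (auto simp: fin_coeffs_def)
    then show "c i \<odot>\<^bsub>A\<^esub> e i \<in> carrier A"
      by simp
  qed
qed (use F in auto)

lemma lin_comb_inject:
  assumes c: "c \<in> fin_coeffs K \<Lambda>" and d: "d \<in> fin_coeffs K \<Lambda>"
    and eq: "lin_comb K A \<Lambda> e c = lin_comb K A \<Lambda> e d"
  shows "c = d"
proof -
  define F where "F = {i \<in> \<Lambda>. c i \<noteq> \<zero>} \<union> {i \<in> \<Lambda>. d i \<noteq> \<zero>}"
  define h where "h = (\<lambda>i\<in>\<Lambda>. c i \<ominus> d i)"
  have F: "finite F" "F \<subseteq> \<Lambda>"
    using c d by (auto simp: F_def fin_coeffs_def)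
  have cK: "c i \<in> carrier K" and dK: "d i \<in> carrier K" if "i \<in> \<Lambda>" for i
    using c d that by (auto simp: fin_coeffs_def)
  have h_add: "h i \<oplus> d i = c i" if "i \<in> \<Lambda>" for i
    using that cK[OF that] dK[OF that] by (simp add: h_def R.minus_eq R.a_assoc R.l_neg)
  have h_supp: "{i \<in> \<Lambda>. h i \<noteq> \<zero>} \<subseteq> F"
    by (auto simp: h_def F_def R.minus_eq)
  have h: "h \<in> fin_coeffs K \<Lambda>"
    using cK dK finite_subset[OF h_supp F(1)] by (auto simp: fin_coeffs_def h_def)
  have closed: "(\<lambda>i. f i \<odot>\<^bsub>A\<^esub> e i) \<in> F \<rightarrow> carrier A" if "f \<in> fin_coeffs K \<Lambda>" for f
  proof
    fix i assume "i \<in> F"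
    then have "i \<in> \<Lambda>" "f i \<in> carrier K"
      using that F(2) by (auto simp: fin_coeffs_def)
    then show "f i \<odot>\<^bsub>A\<^esub> e i \<in> carrier A"
      by simp
  qed
  have "lin_comb K A \<Lambda> e h \<oplus>\<^bsub>A\<^esub> lin_comb K A \<Lambda> e d =
      (\<Oplus>\<^bsub>A\<^esub>i\<in>F. h i \<odot>\<^bsub>A\<^esub> e i) \<oplus>\<^bsub>A\<^esub> (\<Oplus>\<^bsub>A\<^esub>i\<in>F. d i \<odot>\<^bsub>A\<^esub> e i)"
    using lin_comb_superset[OF h F(1) h_supp F(2)] lin_comb_superset[OF d F(1) _ F(2)]
    by (simp add: F_def)
  also have "\<dots> = (\<Oplus>\<^bsub>A\<^esub>i\<in>F. h i \<odot>\<^bsub>A\<^esub> e i \<oplus>\<^bsub>A\<^esub> d i \<odot>\<^bsub>A\<^esub> e i)"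
    using closed[OF h] closed[OF d] by (rule M.finsum_addf[symmetric])
  also have "\<dots> = (\<Oplus>\<^bsub>A\<^esub>i\<in>F. c i \<odot>\<^bsub>A\<^esub> e i)"
  proof (rule M.finsum_cong'[OF refl closed[OF c]])
    fix i assume "i \<in> F"
    then have i: "i \<in> \<Lambda>"
      using F(2) by blast
    have "h i \<in> carrier K"
      using i cK[OF i] dK[OF i] by (simp add: h_def)
    then show "h i \<odot>\<^bsub>A\<^esub> e i \<oplus>\<^bsub>A\<^esub> d i \<odot>\<^bsub>A\<^esub> e i = c i \<odot>\<^bsub>A\<^esub> e i"
      using smult_l_distr[of "h i" "d i" "e i"] i dK[OF i] h_add[OF i] by simp
  qed
  also have "\<dots> = lin_comb K A \<Lambda> e c"
    using lin_comb_superset[OF c F(1) _ F(2)] by (simp add: F_def)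
  finally have "lin_comb K A \<Lambda> e h \<oplus>\<^bsub>A\<^esub> lin_comb K A \<Lambda> e d = lin_comb K A \<Lambda> e d"
    using eq by simp
  moreover have lc: "lin_comb K A \<Lambda> e f \<in> carrier A" if "f \<in> fin_coeffs K \<Lambda>" for f
    using that by (induction rule: lin_comb_induct) auto
  ultimately have "lin_comb K A \<Lambda> e h = \<zero>\<^bsub>A\<^esub>"
    using lc[OF h] lc[OF d] by (metis M.add.r_cancel_one)
  then have h0: "h i = \<zero>" if "i \<in> \<Lambda>" for i
    using basis h that by (simp add: vs_basis_def)
  have "c i = d i" if "i \<in> \<Lambda>" for i
    using h0[OF that] h_add[OF that] dK[OF that] by simp
  moreover have "c \<in> extensional \<Lambda>" "d \<in> extensional \<Lambda>"
    using c d by (auto simp: fin_coeffs_def PiE_def)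
  ultimately show ?thesis
    by (intro extensionalityI)
qed

lemma coordinates_lin_comb:
  assumes c: "c \<in> fin_coeffs K \<Lambda>"
  shows "coordinates K A \<Lambda> e (lin_comb K A \<Lambda> e c) = c"
  unfolding coordinates_def using assms lin_comb_inject by blast

lemma mult_basis_coordinates:
  assumes "x \<in> carrier A" and "i \<in> \<Lambda>"
  shows "x \<otimes>\<^bsub>A\<^esub> e i = coordinates K A \<Lambda> e x i \<odot>\<^bsub>A\<^esub> (e i \<otimes>\<^bsub>A\<^esub> e i)"
    and "coordinates K A \<Lambda> e x i \<in> carrier K"
proof -
  obtain c where c: "c \<in> fin_coeffs K \<Lambda>" "x = lin_comb K A \<Lambda> e c"
    using assms(1) by (rule carrier_cases_lin_comb)
  then have "coordinates K A \<Lambda> e x = c"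
    by (simp add: coordinates_lin_comb)
  then show "x \<otimes>\<^bsub>A\<^esub> e i = coordinates K A \<Lambda> e x i \<odot>\<^bsub>A\<^esub> (e i \<otimes>\<^bsub>A\<^esub> e i)"
    "coordinates K A \<Lambda> e x i \<in> carrier K"
    using c assms(2) lin_comb_mult_basis by (auto simp: fin_coeffs_def)
qed

lemma mult_basis:
  assumes "x \<in> carrier A" and "i \<in> \<Lambda>"
  obtains k where "k \<in> carrier K" and "x \<otimes>\<^bsub>A\<^esub> e i = k \<odot>\<^bsub>A\<^esub> (e i \<otimes>\<^bsub>A\<^esub> e i)"
  using mult_basis_coordinates[OF assms] by blast

text \<open>
  The product is a nonzero scalar multiple of \<open>e\<^sub>i\<^sup>2\<close>, and the scalar can be cancelled.
\<close>

lemma square_mem_ideal: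
  assumes J: "algebra_ideal J K A" and x: "x \<in> J" and i: "i \<in> \<Lambda>"
    and nonzero: "x \<otimes>\<^bsub>A\<^esub> e i \<noteq> \<zero>\<^bsub>A\<^esub>"
  shows "e i \<otimes>\<^bsub>A\<^esub> e i \<in> J"
proof -
  note J_closed = algebra_idealD[OF J]
  have "x \<in> carrier A"
    using x J_closed(1) by blast
  then obtain k where k: "k \<in> carrier K" "x \<otimes>\<^bsub>A\<^esub> e i = k \<odot>\<^bsub>A\<^esub> (e i \<otimes>\<^bsub>A\<^esub> e i)"
    using i by (rule mult_basis)
  have sq: "e i \<otimes>\<^bsub>A\<^esub> e i \<in> carrier A"
    using i by (simp add: mult_closed)
  have "k \<noteq> \<zero>"
    using k nonzero sq by auto
  then have "k \<in> Units K"
    using k(1) by (simp add: field_Units)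
  then have "inv k \<odot>\<^bsub>A\<^esub> (x \<otimes>\<^bsub>A\<^esub> e i) = e i \<otimes>\<^bsub>A\<^esub> e i" and "inv k \<in> carrier K"
    using k sq by (simp_all flip: smult_assoc1)
  moreover have "x \<otimes>\<^bsub>A\<^esub> e i \<in> J"
    using J_closed(7)[of "e i" x] x i by simp
  ultimately show ?thesis
    using J_closed(5) by metis
qed

end


section \<open>Ideals of vectors with prescribed support\<close>

locale evolution_algebra_with_ideal = evolution_algebra K A \<Lambda> e + algebra_with_ideal K A I
  for K (structure) and A (structure) and \<Lambda> :: "'i set" and e :: "'i \<Rightarrow> 'b" and I
begin

text \<open>
  As \<open>x e\<^sub>i \<in> I\<close> means that \<open>e\<^sub>i \<in> H\<^sub>I\<close> or the \<open>i\<close>-th coordinate of \<open>x\<close> is zero, these are the vectors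
  whose coordinates vanish at every vertex of \<open>E/H\<^sub>I\<close> outside \<open>D\<close>; for empty \<open>D\<close> they form the annihilator of \<open>A\<close> modulo \<open>I\<close>. The formulation by products
  replaces the span of \<open>I\<close> and the squares \<open>e\<^sub>i\<^sup>2\<close> with \<open>i \<in> D\<close>, which would serve the same
  purpose, and makes closure properties immediate.
\<close>

definition supported_on :: "'i set \<Rightarrow> 'b set" where
  "supported_on D = {x \<in> carrier A. \<forall>i\<in>\<Lambda> - D. x \<otimes>\<^bsub>A\<^esub> e i \<in> I}"

lemma ideal_subset_supported_on: "I \<subseteq> supported_on D"
  using I_closed(1,7) by (auto simp: supported_on_def)

text \<open>
  The hypothesis says that \<open>e\<^sub>i\<^sup>2\<close> lies in the set for \<open>i \<in> D\<close>. For \<open>x\<close> in the set, \<open>x e\<^sub>i\<close> is a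
  multiple of \<open>e\<^sub>i\<^sup>2\<close> if \<open>i \<in> D\<close>, and lies in \<open>I\<close> otherwise. By linearity this gives closure under
  multiplication by all of \<open>A\<close>.
\<close>

lemma algebra_ideal_supported_on:
  assumes hereditary: "\<And>i j. \<lbrakk>i \<in> \<Lambda> \<inter> D; j \<in> \<Lambda> - D\<rbrakk> \<Longrightarrow> (e i \<otimes>\<^bsub>A\<^esub> e i) \<otimes>\<^bsub>A\<^esub> e j \<in> I"
  shows "algebra_ideal (supported_on D) K A"
proof -
  let ?S = "supported_on D"
  have zero: "\<zero>\<^bsub>A\<^esub> \<in> ?S"
    using I_closed(2) by (simp add: supported_on_def)
  have add: "x \<oplus>\<^bsub>A\<^esub> y \<in> ?S" if "x \<in> ?S" "y \<in> ?S" for x y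
    using that I_closed(4) by (simp add: supported_on_def mult_l_distr)
  have smult: "k \<odot>\<^bsub>A\<^esub> x \<in> ?S" if "k \<in> carrier K" "x \<in> ?S" for k x
    using that I_closed(5) by (simp add: supported_on_def mult_smult_l)
  have basis_mult: "x \<otimes>\<^bsub>A\<^esub> e i \<in> ?S" if x: "x \<in> ?S" and i: "i \<in> \<Lambda>" for x i
  proof (cases "i \<in> D")
    case True
    have "e i \<otimes>\<^bsub>A\<^esub> e i \<in> ?S"
      using hereditary True i by (simp add: supported_on_def mult_closed)
    moreover have "x \<in> carrier A"
      using x by (simp add: supported_on_def)
    then obtain k where "k \<in> carrier K" "x \<otimes>\<^bsub>A\<^esub> e i = k \<odot>\<^bsub>A\<^esub> (e i \<otimes>\<^bsub>A\<^esub> e i)"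
      using i by (rule mult_basis)
    ultimately show ?thesis
      using smult by simp
  next
    case False
    then have "x \<otimes>\<^bsub>A\<^esub> e i \<in> I"
      using x i by (simp add: supported_on_def)
    then show ?thesis
      using ideal_subset_supported_on by blast
  qed
  have right: "x \<otimes>\<^bsub>A\<^esub> y \<in> ?S" if x: "x \<in> ?S" and y: "y \<in> carrier A" for x y
    using y
  proof (induction rule: basis_induct)
    case (smult i k)
    then show ?case
      using x basis_mult[OF x] \<open>\<And>x k. \<lbrakk>k \<in> carrier K; x \<in> ?S\<rbrakk> \<Longrightarrow> k \<odot>\<^bsub>A\<^esub> x \<in> ?S\<close>
      by (simp add: mult_smult_r supported_on_def)
  qed (use x zero add in \<open>simp_all add: mult_r_distr supported_on_def\<close>)
  show ?thesis
  proof (rule algebra_idealI[OF _ zero add smult])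
    fix x y assume "x \<in> carrier A" "y \<in> ?S"
    then show "y \<otimes>\<^bsub>A\<^esub> x \<in> ?S" "x \<otimes>\<^bsub>A\<^esub> y \<in> ?S"
      using right[of y x] mult_commute[of x y] by (auto simp: supported_on_def)
  qed (auto simp: supported_on_def)
qed

text \<open>
  If \<open>x\<close> and \<open>y\<close> have coordinates \<open>k\<^sub>i\<close> and \<open>c\<^sub>i\<close>, then \<open>x y\<close> is the sum of the
  \<open>k\<^sub>i c\<^sub>i e\<^sub>i\<^sup>2\<close>. Each index \<open>i\<close> lies outside \<open>D\<close>, where \<open>k\<^sub>i e\<^sub>i\<^sup>2 = x e\<^sub>i \<in> I\<close>, or
  outside \<open>D'\<close>, where \<open>c\<^sub>i e\<^sub>i\<^sup>2 = y e\<^sub>i \<in> I\<close>.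
\<close>

lemma mult_disjoint_supports:
  assumes x: "x \<in> supported_on D" and y: "y \<in> supported_on D'" and disjoint: "D \<inter> D' = {}"
  shows "x \<otimes>\<^bsub>A\<^esub> y \<in> I"
proof -
  have xA: "x \<in> carrier A" and yA: "y \<in> carrier A"
    using x y by (auto simp: supported_on_def)
  obtain c where c: "c \<in> fin_coeffs K \<Lambda>" "y = lin_comb K A \<Lambda> e c"
    using yA by (rule carrier_cases_lin_comb)
  have scaled_mem: "c i \<odot>\<^bsub>A\<^esub> (x \<otimes>\<^bsub>A\<^esub> e i) \<in> I" if i: "i \<in> \<Lambda>" and ci: "c i \<in> carrier K" for i
  proof (cases "i \<in> D")
    case True
    have yi: "y \<otimes>\<^bsub>A\<^esub> e i \<in> I"
      using True disjoint y i by (auto simp: supported_on_def)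
    obtain k where k: "k \<in> carrier K" "x \<otimes>\<^bsub>A\<^esub> e i = k \<odot>\<^bsub>A\<^esub> (e i \<otimes>\<^bsub>A\<^esub> e i)"
      using xA i by (rule mult_basis)
    have "c i \<odot>\<^bsub>A\<^esub> (x \<otimes>\<^bsub>A\<^esub> e i) = (c i \<otimes> k) \<odot>\<^bsub>A\<^esub> (e i \<otimes>\<^bsub>A\<^esub> e i)"
      using k ci i by (simp add: smult_assoc1 mult_closed)
    also have "\<dots> = k \<odot>\<^bsub>A\<^esub> (c i \<odot>\<^bsub>A\<^esub> (e i \<otimes>\<^bsub>A\<^esub> e i))"
      using k(1) ci i by (simp add: R.m_comm[of "c i"] smult_assoc1 mult_closed)
    also have "c i \<odot>\<^bsub>A\<^esub> (e i \<otimes>\<^bsub>A\<^esub> e i) = y \<otimes>\<^bsub>A\<^esub> e i"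
      using lin_comb_mult_basis[OF c(1) i] c(2) by simp
    finally show ?thesis
      using I_closed(5)[OF k(1) yi] by simp
  next
    case False
    then show ?thesis
      using x i ci I_closed(5) by (simp add: supported_on_def)
  qed
  show ?thesis
    unfolding c(2) using c(1)
  proof (induction rule: lin_comb_induct)
    case (smult i)
    then show ?case
      using scaled_mem xA by (simp add: mult_smult_r)
  qed (use xA I_closed(2,4) in \<open>simp_all add: mult_r_distr\<close>)
qed


section \<open>Edges and paths modulo an ideal\<close>

abbreviation G where
  "G \<equiv> quotient_graph (evolution_graph K A \<Lambda> e) (ideal_vertices A \<Lambda> e I)"

lemma verts_G: "verts G = {e i | i. i \<in> \<Lambda> \<and> e i \<otimes>\<^bsub>A\<^esub> e i \<notin> I}"
  by (auto simp: quotient_graph_def evolution_graph_def ideal_vertices_def)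

text \<open>
  Since \<open>e\<^sub>i\<^sup>2 e\<^sub>j = \<omega>\<^sub>j\<^sub>i e\<^sub>j\<^sup>2\<close>, this product lies outside \<open>I\<close> exactly when \<open>\<omega>\<^sub>j\<^sub>i \<noteq> 0\<close> and
  \<open>e\<^sub>j \<notin> H\<^sub>I\<close>. It then follows that \<open>e\<^sub>i \<notin> H\<^sub>I\<close>, because \<open>I\<close> is an ideal.
\<close>

lemma adj_G_iff:
  assumes i: "i \<in> \<Lambda>" and j: "j \<in> \<Lambda>"
  shows "e i \<rightarrow>\<^bsub>G\<^esub> e j \<longleftrightarrow> (e i \<otimes>\<^bsub>A\<^esub> e i) \<otimes>\<^bsub>A\<^esub> e j \<notin> I"
proof
  have sq: "e l \<otimes>\<^bsub>A\<^esub> e l \<in> carrier A" if "l \<in> \<Lambda>" for l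
    using that by (simp add: mult_closed)
  have coord: "(e l \<otimes>\<^bsub>A\<^esub> e l) \<otimes>\<^bsub>A\<^esub> e m = structure_const K A \<Lambda> e m l \<odot>\<^bsub>A\<^esub> (e m \<otimes>\<^bsub>A\<^esub> e m)"
    "structure_const K A \<Lambda> e m l \<in> carrier K" if "l \<in> \<Lambda>" "m \<in> \<Lambda>" for l m
    using mult_basis_coordinates[OF sq that(2)] that by (simp_all add: structure_const_def)
  {
    assume "e i \<rightarrow>\<^bsub>G\<^esub> e j"
    then obtain l m where lm: "l \<in> \<Lambda>" "m \<in> \<Lambda>" "e i = e l" "e j = e m"
      "structure_const K A \<Lambda> e m l \<noteq> \<zero>" and notin: "e m \<otimes>\<^bsub>A\<^esub> e m \<notin> I"
      by (auto simp: quotient_graph_def evolution_graph_def ideal_vertices_def arcs_ends_def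
        arc_to_ends_def)
    let ?w = "structure_const K A \<Lambda> e m l"
    have w: "?w \<in> carrier K" "?w \<in> Units K"
      using lm coord by (simp_all add: field_Units)
    show "(e i \<otimes>\<^bsub>A\<^esub> e i) \<otimes>\<^bsub>A\<^esub> e j \<notin> I"
    proof
      assume "(e i \<otimes>\<^bsub>A\<^esub> e i) \<otimes>\<^bsub>A\<^esub> e j \<in> I"
      then have "inv ?w \<odot>\<^bsub>A\<^esub> (?w \<odot>\<^bsub>A\<^esub> (e m \<otimes>\<^bsub>A\<^esub> e m)) \<in> I"
        using lm coord(1)[OF lm(1,2)] w I_closed(5) by simp
      then show False
        using w sq[OF lm(2)] notin by (simp flip: smult_assoc1)
    qed
  next
    assume notin: "(e i \<otimes>\<^bsub>A\<^esub> e i) \<otimes>\<^bsub>A\<^esub> e j \<notin> I"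
    then have "e i \<otimes>\<^bsub>A\<^esub> e i \<notin> I"
      using I_closed(7) j by auto
    moreover have "e j \<otimes>\<^bsub>A\<^esub> e j \<notin> I"
      using notin coord[OF i j] I_closed(5) by auto
    moreover have "structure_const K A \<Lambda> e j i \<noteq> \<zero>"
      using notin coord[OF i j] sq[OF j] I_closed(2) by auto
    ultimately show "e i \<rightarrow>\<^bsub>G\<^esub> e j"
      using i j by (auto simp: quotient_graph_def evolution_graph_def ideal_vertices_def
        arcs_ends_def arc_to_ends_def image_iff)
  }
qed

lemma wf_digraph_G: "wf_digraph G"
  by unfold_locales (auto simp: quotient_graph_def)

text \<open>
  Along an edge from \<open>v\<close> to \<open>w\<close>, the product \<open>v\<^sup>2 w\<close> is a nonzero element of the ideal, so
  \<open>square_mem_ideal\<close> applies.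
\<close>

lemma square_mem_ideal_reachable:
  assumes J: "algebra_ideal J K A"
    and reach: "u \<rightarrow>\<^sup>*\<^bsub>G\<^esub> v" and u: "u \<otimes>\<^bsub>A\<^esub> u \<in> J"
  shows "v \<otimes>\<^bsub>A\<^esub> v \<in> J"
  using reach unfolding reachable_def
proof (induction rule: rtrancl_on_induct)
  case base
  then show ?case using u by simp
next
  case (step v w)
  then obtain i j where ij: "i \<in> \<Lambda>" "v = e i" "j \<in> \<Lambda>" "w = e j"
    by (auto simp: verts_G)
  then have "(v \<otimes>\<^bsub>A\<^esub> v) \<otimes>\<^bsub>A\<^esub> e j \<noteq> \<zero>\<^bsub>A\<^esub>"
    using step adj_G_iff I_closed(2) by auto
  then show ?case
    using square_mem_ideal[OF J] step ij by simp
qed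


section \<open>Primeness and common descendants\<close>

lemma downward_directed_if_prime:
  assumes prime: "prime_algebra K Q"
  shows "downward_directed G"
  unfolding downward_directed_def
proof (intro ballI)
  fix u v assume uv: "u \<in> verts G" "v \<in> verts G"
  define D where "D w = {i \<in> \<Lambda>. w \<rightarrow>\<^sup>*\<^bsub>G\<^esub> e i}" for w
  have hereditary: "(e i \<otimes>\<^bsub>A\<^esub> e i) \<otimes>\<^bsub>A\<^esub> e j \<in> I" if "i \<in> D w" "j \<in> \<Lambda> - D w" for i j w
  proof (rule ccontr)
    assume notin: "(e i \<otimes>\<^bsub>A\<^esub> e i) \<otimes>\<^bsub>A\<^esub> e j \<notin> I"
    then have adj: "e i \<rightarrow>\<^bsub>G\<^esub> e j"
      using that adj_G_iff by (simp add: D_def)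
    then have "w \<rightarrow>\<^sup>*\<^bsub>G\<^esub> e j"
      using that wf_digraph.reachable_adj_trans[OF wf_digraph_G] by (auto simp: D_def)
    then show False
      using that by (simp add: D_def)
  qed
  have ideal: "algebra_ideal (supported_on (D w)) K A" for w
    using hereditary by (intro algebra_ideal_supported_on) blast
  have larger: "supported_on (D w) \<noteq> I" if w: "w \<in> verts G" for w
  proof -
    obtain i where i: "i \<in> \<Lambda>" "w = e i" "e i \<otimes>\<^bsub>A\<^esub> e i \<notin> I"
      using w by (auto simp: verts_G)
    then have "i \<in> D w"
      using w by (simp add: D_def reachable_def)
    then have "e i \<otimes>\<^bsub>A\<^esub> e i \<in> supported_on (D w)"
      using hereditary i by (simp add: supported_on_def mult_closed)
    then show ?thesis
      using i(3) by blast
  qed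
  have "\<not> (\<forall>x\<in>supported_on (D u). \<forall>y\<in>supported_on (D v). x \<otimes>\<^bsub>A\<^esub> y \<in> I)"
    using prime[unfolded prime_quotient_iff, rule_format,
        OF ideal ideal_subset_supported_on ideal ideal_subset_supported_on, of u v]
      larger[OF uv(1)] larger[OF uv(2)] by blast
  then obtain i where "i \<in> D u" "i \<in> D v"
    using mult_disjoint_supports by blast
  then have "u \<rightarrow>\<^sup>*\<^bsub>G\<^esub> e i" "v \<rightarrow>\<^sup>*\<^bsub>G\<^esub> e i"
    by (simp_all add: D_def)
  moreover from this have "e i \<in> verts G"
    unfolding reachable_def by (blast dest: in_rtrancl_on_in_F)
  ultimately show "\<exists>z\<in>verts G. u \<rightarrow>\<^sup>*\<^bsub>G\<^esub> z \<and> v \<rightarrow>\<^sup>*\<^bsub>G\<^esub> z"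
    by blast
qed

text \<open>
  By semiprimeness the annihilator of \<open>A\<close> modulo \<open>I\<close> is \<open>I\<close> itself, so some \<open>x\<close> in the larger
  ideal has \<open>x e\<^sub>i \<notin> I\<close>; this product is a multiple of \<open>e\<^sub>i\<^sup>2\<close>.
\<close>

lemma larger_ideal_contains_square:
  assumes semiprime: "semiprime_algebra K Q"
    and J: "algebra_ideal J K A" "I \<subseteq> J" "J \<noteq> I"
  obtains i where "i \<in> \<Lambda>" and "e i \<otimes>\<^bsub>A\<^esub> e i \<in> J" and "e i \<otimes>\<^bsub>A\<^esub> e i \<notin> I"
proof -
  have "algebra_ideal (supported_on {}) K A"
    by (rule algebra_ideal_supported_on) simp
  then have "supported_on {} = I"
    using semiprime ideal_subset_supported_on mult_disjoint_supports[of _ "{}" _ "{}"]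
    unfolding semiprime_quotient_iff by blast
  with J obtain x where x: "x \<in> J" "x \<notin> supported_on {}"
    by blast
  then obtain i where i: "i \<in> \<Lambda>" "x \<otimes>\<^bsub>A\<^esub> e i \<notin> I"
    using algebra_idealD(1)[OF J(1)] by (auto simp: supported_on_def)
  have "e i \<otimes>\<^bsub>A\<^esub> e i \<in> J"
    using square_mem_ideal[OF J(1) x(1) i(1)] i(2) I_closed(2) by metis
  moreover have "e i \<otimes>\<^bsub>A\<^esub> e i \<notin> I"
  proof
    assume "e i \<otimes>\<^bsub>A\<^esub> e i \<in> I"
    moreover obtain k where "k \<in> carrier K" "x \<otimes>\<^bsub>A\<^esub> e i = k \<odot>\<^bsub>A\<^esub> (e i \<otimes>\<^bsub>A\<^esub> e i)"
      using x(1) i(1) algebra_idealD(1)[OF J(1)] mult_basis by blast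
    ultimately show False
      using i(2) I_closed(5) by simp
  qed
  ultimately show ?thesis
    using that i(1) by blast
qed

lemma prime_if_downward_directed_semiprime:
  assumes directed: "downward_directed G" and semiprime: "semiprime_algebra K Q"
  shows "prime_algebra K Q"
  unfolding prime_quotient_iff
proof (intro allI impI, rule ccontr)
  fix J L
  assume J: "algebra_ideal J K A" "I \<subseteq> J" and L: "algebra_ideal L K A" "I \<subseteq> L"
    and prod: "\<forall>x\<in>J. \<forall>y\<in>L. x \<otimes>\<^bsub>A\<^esub> y \<in> I" and "\<not> (J = I \<or> L = I)"
  then have "J \<noteq> I" "L \<noteq> I"
    by blast+
  obtain i where i: "i \<in> \<Lambda>" "e i \<otimes>\<^bsub>A\<^esub> e i \<in> J" "e i \<otimes>\<^bsub>A\<^esub> e i \<notin> I"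
    using semiprime J \<open>J \<noteq> I\<close> by (rule larger_ideal_contains_square)
  obtain j where j: "j \<in> \<Lambda>" "e j \<otimes>\<^bsub>A\<^esub> e j \<in> L" "e j \<otimes>\<^bsub>A\<^esub> e j \<notin> I"
    using semiprime L \<open>L \<noteq> I\<close> by (rule larger_ideal_contains_square)
  have "e i \<in> verts G" "e j \<in> verts G"
    using i j by (auto simp: verts_G)
  then obtain z where z: "z \<in> verts G" "e i \<rightarrow>\<^sup>*\<^bsub>G\<^esub> z" "e j \<rightarrow>\<^sup>*\<^bsub>G\<^esub> z"
    using directed unfolding downward_directed_def by blast
  have "z \<otimes>\<^bsub>A\<^esub> z \<in> J \<inter> L"
    using square_mem_ideal_reachable[OF J(1) z(2)] square_mem_ideal_reachable[OF L(1) z(3)] i j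
    by blast
  moreover have "J \<inter> L = I"
    using semiprime algebra_ideal_Int[OF J(1) L(1)] J(2) L(2) prod
    unfolding semiprime_quotient_iff by (metis IntD1 IntD2 le_inf_iff)
  ultimately show False
    using z(1) by (auto simp: verts_G)
qed

end

theorem theorem3p21:
  fixes K :: "('k, 'r) ring_scheme"
    and A :: "('k, 'a, 'm) module_scheme"
    and \<Lambda> :: "'i set"
    and e :: "'i \<Rightarrow> 'a"
    and I :: "'a set"
  assumes "evolution_algebra K A \<Lambda> e"
    and "algebra_ideal I K A"
    and "I \<noteq> carrier A"
  shows "prime_algebra_ideal K A I \<longleftrightarrow>
    downward_directed (quotient_graph (evolution_graph K A \<Lambda> e) (ideal_vertices A \<Lambda> e I)) \<and>
    semiprime_algebra K (quotient_algebra A I)"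
proof -
  interpret evolution_algebra_with_ideal K A \<Lambda> e I
    using assms(1,2)
    by (simp add: evolution_algebra_with_ideal_def algebra_with_ideal_def evolution_algebra_def)
  have "semiprime_algebra K (quotient_algebra A I)" if "prime_algebra K (quotient_algebra A I)"
    using that unfolding prime_algebra_def semiprime_algebra_def by blast
  then show ?thesis
    using assms downward_directed_if_prime prime_if_downward_directed_semiprime
    unfolding prime_algebra_ideal_def by blast
qed

end
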